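(* Let $G$ be a graph of order $n$ with maximum degree $\Delta$. If $n$ is even, then $c^A_g(G)\le \frac n2+2\Delta$ and $c^I_g(G)\le \frac n2+3\Delta$. If $n$ is odd, then $c^A_g(G)\le \frac n2+3\Delta$ and $c^I_g(G)\le \frac n2+2\Delta$.
   Context: The cordiality game on a finite simple graph $G$ is played by two players, Admirable (A) and Impish (I), who alternately select a not-yet-labeled vertex of $G$ until all vertices are labeled; Admirable labels each vertex she selects by $0$ and Impish labels each vertex he selects by $1$. Each edge receives the sum modulo $2$ of the labels of its endpoints. Let $e_0$ and $e_1$ be the numbers of edges labeled $0$ and $1$ at the end; the discrepancy is $d=|e_1-e_0|$. Admirable tries to minimize $d$ and Impish tries to maximize $d$. $c^A_g(G)$ is the value of $d$ under optimal play of both players when Admirable moves first, and $c^I_g(G)$ is the value under optimal play when Impish moves first. *)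

theory Defs
  imports Complex_Main
begin

definition simple_graph :: "'a set \<Rightarrow> 'a set set \<Rightarrow> bool" where
  "simple_graph V E \<longleftrightarrow> finite V \<and> (\<forall>e\<in>E. e \<subseteq> V \<and> card e = 2)"

definition degree :: "'a set set \<Rightarrow> 'a \<Rightarrow> nat" where
  "degree E v = card {e \<in> E. v \<in> e}"

text \<open>On \<^typ>\<open>nat\<close> the supremum of a finite nonempty set is its maximum, and the
  supremum of the empty set is 0; so this is also defined for the graph without vertices.\<close>

definition max_degree :: "'a set \<Rightarrow> 'a set set \<Rightarrow> nat" where
  "max_degree V E = (SUP v\<in>V. degree E v)"

definition edge_label :: "('a \<Rightarrow> nat) \<Rightarrow> 'a set \<Rightarrow> nat" where
  "edge_label f e = (\<Sum>v\<in>e. f v) mod 2"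

definition edge_count :: "'a set set \<Rightarrow> ('a \<Rightarrow> nat) \<Rightarrow> nat \<Rightarrow> nat" where
  "edge_count E f i = card {e \<in> E. edge_label f e = i}"

definition discrepancy :: "'a set set \<Rightarrow> ('a \<Rightarrow> nat) \<Rightarrow> int" where
  "discrepancy E f = \<bar>int (edge_count E f 1) - int (edge_count E f 0)\<bar>"

datatype player = Admirable | Impish

text \<open>A position is a partial labeling \<open>m\<close> of the vertices together with the player to move;
  its value is computed by backward induction. The finiteness test serves only to make the
  recursion terminate for arbitrary arguments.\<close>

function game_value :: "'a set \<Rightarrow> 'a set set \<Rightarrow> player \<Rightarrow> ('a \<rightharpoonup> nat) \<Rightarrow> int" where
  "game_value V E p m =
     (if finite V \<and> V - dom m \<noteq> {} then
        (case p of
           Admirable \<Rightarrow> Min ((\<lambda>v. game_value V E Impish (m(v \<mapsto> 0))) ` (V - dom m))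
         | Impish \<Rightarrow> Max ((\<lambda>v. game_value V E Admirable (m(v \<mapsto> 1))) ` (V - dom m)))
      else discrepancy E (\<lambda>v. the (m v)))"
  by pat_completeness auto
termination
proof (relation "measure (\<lambda>(V, E, p, m). card (V - dom m))")
  fix V :: "'a set" and E :: "'a set set" and m :: "'a \<rightharpoonup> nat" and v
  assume "finite V \<and> V - dom m \<noteq> {}" and "v \<in> V - dom m"
  then have *: "card (V - dom (m(v \<mapsto> i))) < card (V - dom m)" for i
    by (intro psubset_card_mono) auto
  show "((V, E, Impish, m(v \<mapsto> 0)), (V, E, p, m))
      \<in> measure (\<lambda>(V, E, p, m). card (V - dom m))" for p
    using * by simp
  show "((V, E, Admirable, m(v \<mapsto> 1)), (V, E, p, m))
      \<in> measure (\<lambda>(V, E, p, m). card (V - dom m))" for p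
    using * by simp
qed simp

declare game_value.simps [simp del]

definition cordiality_A :: "'a set \<Rightarrow> 'a set set \<Rightarrow> int" where
  "cordiality_A V E = game_value V E Admirable Map.empty"

definition cordiality_I :: "'a set \<Rightarrow> 'a set set \<Rightarrow> int" where
  "cordiality_I V E = game_value V E Impish Map.empty"

end

(* Give label 0 the spin 1, label 1 the spin -1 and an unlabeled vertex the spin 0, so that the
   discrepancy is |S|, where S is the sum over the edges of the product of the spins. Labeling v
   with spin c changes S by c * w(v), where w(v), the sum of the spins of the neighbors of v, is
   at most Delta in absolute value. Admirable picks a vertex with minimal w if S >= 0 and one with
   maximal w if S < 0. Whatever Impish answers, the round changes S by at most 2 * Delta; it does
   not increase S in the first case and decreases S by at most 1 in the second, since Admirable's
   own move raises the other weights by at most 1. Hence -2 * Delta - t <= S <= 2 * Delta after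
   t rounds, and only a single last move of Admirable can cost another Delta. An opening
   move of Impish leaves S = 0. *)

theory Submission
  imports Defs
begin

section \<open>Spins, the signed edge sum and vertex weights\<close>

definition spin :: "('a \<rightharpoonup> nat) \<Rightarrow> 'a \<Rightarrow> int" where
  "spin m v = (case m v of None \<Rightarrow> 0 | Some i \<Rightarrow> if i = 0 then 1 else -1)"

text \<open>With spins of a partial 0/1 labeling, edges that have an unlabeled end vanish, so this
  is the current number of edges labeled 0 minus the number labeled 1.\<close>

definition spin_sum :: "'a set set \<Rightarrow> ('a \<Rightarrow> int) \<Rightarrow> int" where
  "spin_sum E x = (\<Sum>e\<in>E. \<Prod>v\<in>e. x v)"

text \<open>In a simple graph \<open>e - {v}\<close> is a singleton, so each product is the spin of
  one neighbor. In product form the sum is visibly the coefficient of \<open>x v\<close> in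
  \<open>spin_sum E x\<close>.\<close>

definition weight :: "'a set set \<Rightarrow> ('a \<Rightarrow> int) \<Rightarrow> 'a \<Rightarrow> int" where
  "weight E x v = (\<Sum>e | e \<in> E \<and> v \<in> e. \<Prod>u\<in>e - {v}. x u)"

lemma spin_upd: "spin (m(v \<mapsto> i)) = (spin m)(v := if i = 0 then 1 else -1)"
  by (auto simp: spin_def)

lemma spin_notin_dom: "v \<notin> dom m \<Longrightarrow> spin m v = 0"
  by (simp add: spin_def domIff)

lemma abs_spin_le_1: "\<bar>spin m v\<bar> \<le> 1"
  by (auto simp: spin_def split: option.split)

lemma simple_graph_finite: "simple_graph V E \<Longrightarrow> finite V"
  by (simp add: simple_graph_def)

lemma simple_graph_finite_edges: "simple_graph V E \<Longrightarrow> finite E"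
  by (rule finite_subset[of _ "Pow V"]) (auto simp: simple_graph_def)

lemma simple_graph_finite_edge: "simple_graph V E \<Longrightarrow> e \<in> E \<Longrightarrow> finite e"
  by (metis card.infinite simple_graph_def zero_neq_numeral)

text \<open>The product over an edge at \<open>v\<close> is linear in \<open>x v\<close> and
  vanishes while \<open>x v = 0\<close>; all other edges keep their product. The cases
  \<open>c = 1\<close> and \<open>c = -1\<close> are the moves of Admirable and Impish.\<close>

lemma spin_sum_upd:
  assumes "simple_graph V E" and "x v = 0"
  shows "spin_sum E (x(v := c)) = spin_sum E x + c * weight E x v"
proof -
  let ?y = "x(v := c)"
  have edge: "prod ?y e = prod x e + (if v \<in> e then c * prod x (e - {v}) else 0)"
    if "e \<in> E" for e
  proof (cases "v \<in> e")
    case True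
    have fin: "finite e" using simple_graph_finite_edge[OF assms(1) that] .
    have "prod ?y e = c * prod ?y (e - {v})"
      using prod.remove[OF fin True, of ?y] by simp
    also have "prod ?y (e - {v}) = prod x (e - {v})"
      by (rule prod.cong) auto
    finally show ?thesis
      using prod.remove[OF fin True, of x] True assms(2) by simp
  next
    case False
    then have "prod ?y e = prod x e" by (intro prod.cong) auto
    then show ?thesis using False by simp
  qed
  have "spin_sum E ?y = (\<Sum>e\<in>E. prod x e + (if v \<in> e then c * prod x (e - {v}) else 0))"
    unfolding spin_sum_def by (rule sum.cong[OF refl edge])
  also have "\<dots> = spin_sum E x + (\<Sum>e\<in>E. if v \<in> e then c * prod x (e - {v}) else 0)"
    by (simp add: spin_sum_def sum.distrib)
  also have "(\<Sum>e\<in>E. if v \<in> e then c * prod x (e - {v}) else 0) = c * weight E x v"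
    using simple_graph_finite_edges[OF assms(1)]
    by (simp add: weight_def sum_distrib_left sum.inter_filter[symmetric])
  finally show ?thesis .
qed

lemma abs_prod_le_1:
  fixes x :: "'a \<Rightarrow> int"
  assumes "\<And>u. \<bar>x u\<bar> \<le> 1"
  shows "\<bar>prod x A\<bar> \<le> 1"
  using assms by (induction A rule: infinite_finite_induct) (auto simp: abs_mult intro: mult_le_one)

lemma abs_weight_le:
  assumes "simple_graph V E" and "v \<in> V" and "\<And>u. \<bar>x u\<bar> \<le> 1"
  shows "\<bar>weight E x v\<bar> \<le> int (max_degree V E)"
proof -
  have "\<bar>weight E x v\<bar> \<le> (\<Sum>e | e \<in> E \<and> v \<in> e. \<bar>\<Prod>u\<in>e - {v}. x u\<bar>)"
    unfolding weight_def by (rule sum_abs)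
  also have "\<dots> \<le> (\<Sum>e | e \<in> E \<and> v \<in> e. 1)"
    by (intro sum_mono abs_prod_le_1 assms(3))
  also have "\<dots> = int (degree E v)"
    by (simp add: degree_def)
  also have "degree E v \<le> max_degree V E"
    unfolding max_degree_def using assms(1,2)
    by (intro cSUP_upper) (auto simp: simple_graph_def)
  finally show ?thesis by simp
qed

text \<open>For an edge \<open>e\<close> at \<open>u\<close>, the product over
  \<open>e - {u}\<close> sees only the other endpoint, so it changes only for
  \<open>e = {u, v}\<close>, and there from 0 to 1.\<close>

lemma weight_upd:
  assumes "simple_graph V E" and "u \<noteq> v" and "x v = 0"
  shows "weight E (x(v := 1)) u = weight E x u + of_bool ({u, v} \<in> E)"
proof -
  have edge: "prod (x(v := 1)) (e - {u}) = prod x (e - {u}) + of_bool (e = {u, v})"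
    if e: "e \<in> E" "u \<in> e" for e
  proof -
    have "card e = 2" using assms(1) e(1) by (simp add: simple_graph_def)
    then obtain w where "e = {u, w}" "w \<noteq> u"
      using e(2) by (auto simp: card_2_iff)
    then show ?thesis using assms(2,3) by (auto simp: doubleton_eq_iff)
  qed
  have "weight E (x(v := 1)) u
      = (\<Sum>e | e \<in> E \<and> u \<in> e. prod x (e - {u}) + of_bool (e = {u, v}))"
    unfolding weight_def by (rule sum.cong[OF refl edge]) auto
  also have "\<dots> = weight E x u + (\<Sum>e | e \<in> E \<and> u \<in> e. of_bool (e = {u, v}))"
    by (simp add: weight_def sum.distrib)
  also have "(\<Sum>e | e \<in> E \<and> u \<in> e. of_bool (e = {u, v})) = of_bool ({u, v} \<in> E)"
    using simple_graph_finite_edges[OF assms(1)] by (simp add: of_bool_def sum.delta)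
  finally show ?thesis .
qed

text \<open>Spins turn addition mod 2 into multiplication of signs: the product over an edge is 1
  when its label is 0 and -1 when its label is 1.\<close>

lemma discrepancy_eq_spin_sum:
  assumes "simple_graph V E" and "V \<subseteq> dom m" and "ran m \<subseteq> {0, 1}"
  shows "discrepancy E (\<lambda>v. the (m v)) = \<bar>spin_sum E (spin m)\<bar>"
proof -
  let ?f = "\<lambda>v. the (m v)"
  have edge: "of_bool (edge_label ?f e = 0) - of_bool (edge_label ?f e = 1) = prod (spin m) e"
    if "e \<in> E" for e
  proof -
    have "card e = 2" "e \<subseteq> V" using assms(1) that by (auto simp: simple_graph_def)
    then obtain a b where ab: "e = {a, b}" "a \<noteq> b" "a \<in> V" "b \<in> V"
      by (auto simp: card_2_iff)
    obtain i j where ij: "m a = Some i" "m b = Some j"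
      using ab(3,4) assms(2) by blast
    then have "i \<in> {0, 1}" "j \<in> {0, 1}" using assms(3) by (auto dest: ranI)
    then show ?thesis using ab(1,2) ij by (auto simp: edge_label_def spin_def)
  qed
  have count: "int (edge_count E ?f i) = (\<Sum>e\<in>E. of_bool (edge_label ?f e = i))" for i
    using simple_graph_finite_edges[OF assms(1)]
    by (simp add: edge_count_def of_bool_def sum.inter_filter[symmetric])
  have "int (edge_count E ?f 0) - int (edge_count E ?f 1) = spin_sum E (spin m)"
    unfolding count spin_sum_def sum_subtractf[symmetric] by (rule sum.cong[OF refl edge])
  then show ?thesis by (simp add: discrepancy_def)
qed

section \<open>Bounding game values through single moves\<close>

lemma game_value_Admirable_le:
  assumes "finite V" and "v \<in> V - dom m"
  shows "game_value V E Admirable m \<le> game_value V E Impish (m(v \<mapsto> 0))"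
  using assms by (subst game_value.simps) (auto intro!: Min_le)

lemma game_value_Impish_le:
  assumes "finite V" and "V - dom m \<noteq> {}"
    and "\<And>v. v \<in> V - dom m \<Longrightarrow> game_value V E Admirable (m(v \<mapsto> 1)) \<le> b"
  shows "game_value V E Impish m \<le> b"
  using assms by (subst game_value.simps) auto

lemma game_value_final:
  assumes "simple_graph V E" and "V \<subseteq> dom m" and "ran m \<subseteq> {0, 1}"
  shows "game_value V E p m = \<bar>spin_sum E (spin m)\<bar>"
proof -
  have "V - dom m = {}" using assms(2) by blast
  then show ?thesis
    using discrepancy_eq_spin_sum[OF assms] by (subst game_value.simps) simp
qed

lemma ran_upd_subset: "ran m \<subseteq> A \<Longrightarrow> i \<in> A \<Longrightarrow> ran (m(v \<mapsto> i)) \<subseteq> A"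
  by (auto simp: ran_def)

section \<open>Admirable's strategy\<close>

text \<open>One round of the strategy keeps the invariant; \<open>t\<close> counts the completed
  rounds, each of which may lower the floor by 1. If \<open>v\<close> is the last free vertex, the
  claim about replies is vacuous.\<close>

lemma round_bound:
  fixes m :: "'a \<rightharpoonup> nat" and t :: nat
  assumes G: "simple_graph V E" and ne: "V - dom m \<noteq> {}"
    and lower: "- (2 * int (max_degree V E) + int t) \<le> spin_sum E (spin m)"
    and upper: "spin_sum E (spin m) \<le> 2 * int (max_degree V E)"
  obtains v where "v \<in> V - dom m"
    and "\<And>u. u \<in> V - dom m - {v} \<Longrightarrow>
      - (2 * int (max_degree V E) + int (Suc t)) \<le> spin_sum E (spin (m(v \<mapsto> 0, u \<mapsto> 1))) \<and>
      spin_sum E (spin (m(v \<mapsto> 0, u \<mapsto> 1))) \<le> 2 * int (max_degree V E)"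
proof -
  let ?w = "weight E (spin m)" and ?S = "spin_sum E (spin m)" and ?D = "int (max_degree V E)"
  have fin: "finite (V - dom m)" using simple_graph_finite[OF G] by simp
  have "\<exists>v\<in>V - dom m. (?S \<ge> 0 \<longrightarrow> (\<forall>u\<in>V - dom m. ?w v \<le> ?w u)) \<and>
                      (?S < 0 \<longrightarrow> (\<forall>u\<in>V - dom m. ?w u \<le> ?w v))"
  proof (cases "?S \<ge> 0")
    case True
    have "Min (?w ` (V - dom m)) \<in> ?w ` (V - dom m)"
      using fin ne by (intro Min_in) auto
    then obtain v where "v \<in> V - dom m" "?w v = Min (?w ` (V - dom m))"
      by (metis imageE)
    then show ?thesis using True fin by (intro bexI[of _ v]) auto
  next
    case False
    have "Max (?w ` (V - dom m)) \<in> ?w ` (V - dom m)"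
      using fin ne by (intro Max_in) auto
    then obtain v where "v \<in> V - dom m" "?w v = Max (?w ` (V - dom m))"
      by (metis imageE)
    then show ?thesis using False fin by (intro bexI[of _ v]) auto
  qed
  then obtain v where v: "v \<in> V - dom m"
    and low: "\<And>u. ?S \<ge> 0 \<Longrightarrow> u \<in> V - dom m \<Longrightarrow> ?w v \<le> ?w u"
    and high: "\<And>u. ?S < 0 \<Longrightarrow> u \<in> V - dom m \<Longrightarrow> ?w u \<le> ?w v"
    by blast
  show thesis
  proof (rule that[OF v])
    fix u assume u: "u \<in> V - dom m - {v}"
    let ?w' = "weight E (spin (m(v \<mapsto> 0)))"
    have "spin_sum E (spin (m(v \<mapsto> 0, u \<mapsto> 1))) = spin_sum E (spin (m(v \<mapsto> 0))) - ?w' u"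
      using spin_sum_upd[OF G, of "spin (m(v \<mapsto> 0))" u "-1"] u
      by (simp add: spin_upd[where i = "Suc 0"] spin_notin_dom)
    also have "spin_sum E (spin (m(v \<mapsto> 0))) = ?S + ?w v"
      using spin_sum_upd[OF G, of "spin m" v 1] v by (simp add: spin_upd spin_notin_dom)
    finally have S': "spin_sum E (spin (m(v \<mapsto> 0, u \<mapsto> 1))) = ?S + ?w v - ?w' u" .
    \<comment> \<open>Impish moves after Admirable, so his gain is measured by \<open>?w'\<close>,
      which exceeds \<open>?w\<close> by 1 exactly at the neighbors of \<open>v\<close>.\<close>
    have w': "?w u \<le> ?w' u" "?w' u \<le> ?w u + 1"
      using weight_upd[OF G, of u v "spin m"] u v by (auto simp: spin_upd spin_notin_dom)
    have D: "\<bar>?w v\<bar> \<le> ?D" "\<bar>?w' u\<bar> \<le> ?D"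
      using u v by (auto intro!: abs_weight_le[OF G] abs_spin_le_1)
    show "- (2 * ?D + int (Suc t)) \<le> spin_sum E (spin (m(v \<mapsto> 0, u \<mapsto> 1))) \<and>
      spin_sum E (spin (m(v \<mapsto> 0, u \<mapsto> 1))) \<le> 2 * ?D"
      \<comment> \<open>If \<open>?S \<ge> 0\<close>, then
        \<open>?w v \<le> ?w u \<le> ?w' u\<close>, so the sum does not grow, and it drops by at
        most \<open>2 * ?D\<close>. If \<open>?S < 0\<close>, then
        \<open>?w' u \<le> ?w v + 1\<close>, so the sum drops by at most 1, and it rises by at most
        \<open>2 * ?D\<close> from a negative value.\<close>
      unfolding S' using low[of u] high[of u] u w' D lower upper
      by (cases "?S \<ge> 0") auto
  qed
qed

text \<open>A round uses up two vertices, so \<open>k div 2\<close> full rounds remain and the floor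
  can still fall by that much. For odd \<open>k\<close> Admirable moves once more without a reply,
  which costs at most one further maximum degree. The induction must leave \<open>t\<close> free,
  since it grows as \<open>k\<close> shrinks.\<close>

lemma game_value_bound:
  assumes G: "simple_graph V E" and "ran m \<subseteq> {0, 1}"
    and "- (2 * int (max_degree V E) + int t) \<le> spin_sum E (spin m)"
    and "spin_sum E (spin m) \<le> 2 * int (max_degree V E)"
    and "card (V - dom m) = k"
  shows "game_value V E Admirable m \<le> 2 * int (max_degree V E) + int t + int (k div 2)
           + (if odd k then int (max_degree V E) else 0)"
  using assms(2-)
proof (induction k arbitrary: m t rule: less_induct)
  case (less k)
  let ?D = "int (max_degree V E)"
  have finV: "finite V" using simple_graph_finite[OF G] .
  show ?case
  proof (cases "V - dom m = {}")
    case True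
    then have "k = 0" using less.prems(4) by (simp only: card.empty)
    have "V \<subseteq> dom m" using True by blast
    then have "game_value V E Admirable m = \<bar>spin_sum E (spin m)\<bar>"
      by (rule game_value_final[OF G _ less.prems(1)])
    then show ?thesis using less.prems(2,3) \<open>k = 0\<close> by simp
  next
    case False
    obtain v where v: "v \<in> V - dom m"
      and inv: "\<And>u. u \<in> V - dom m - {v} \<Longrightarrow>
        - (2 * ?D + int (Suc t)) \<le> spin_sum E (spin (m(v \<mapsto> 0, u \<mapsto> 1))) \<and>
        spin_sum E (spin (m(v \<mapsto> 0, u \<mapsto> 1))) \<le> 2 * ?D"
      using round_bound[OF G False less.prems(2,3)] by blast
    have ran0: "ran (m(v \<mapsto> 0)) \<subseteq> {0, 1}"
      using less.prems(1) by (rule ran_upd_subset) simp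
    have dom0: "V - dom (m(v \<mapsto> 0)) = V - dom m - {v}" by auto
    show ?thesis
    proof (cases "V - dom m - {v} = {}")
      case True
      then have "V - dom m = {v}" using v by auto
      then have k: "k = 1" using less.prems(4) by simp
      have "game_value V E Admirable m \<le> game_value V E Impish (m(v \<mapsto> 0))"
        by (rule game_value_Admirable_le[OF finV v])
      also have "\<dots> = \<bar>spin_sum E (spin (m(v \<mapsto> 0)))\<bar>"
        using True by (intro game_value_final[OF G _ ran0]) auto
      also have "spin_sum E (spin (m(v \<mapsto> 0))) = spin_sum E (spin m) + weight E (spin m) v"
        using spin_sum_upd[OF G, of "spin m" v 1] v by (simp add: spin_upd spin_notin_dom)
      \<comment> \<open>The invariant bounds the sum before the unanswered last move; that move adds
        a weight of absolute value at most \<open>?D\<close>.\<close>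
      also have "\<bar>\<dots>\<bar> \<le> 2 * ?D + int t + ?D"
        using abs_weight_le[OF G, of v "spin m"] v abs_spin_le_1[of m] less.prems(2,3) by auto
      finally show ?thesis using k by simp
    next
      case False
      have card: "card (V - dom m - {v} - {u}) = k - 2" "k \<ge> 2"
        if "u \<in> V - dom m - {v}" for u
      proof -
        have "card (V - dom m) = Suc (Suc (card (V - dom m - {v} - {u})))"
          using finV v that card.remove[of "V - dom m" v] card.remove[of "V - dom m - {v}" u]
          by simp
        then show "card (V - dom m - {v} - {u}) = k - 2" "k \<ge> 2"
          using less.prems(4) by auto
      qed
      have "game_value V E Admirable m \<le> game_value V E Impish (m(v \<mapsto> 0))"
        by (rule game_value_Admirable_le[OF finV v])
      also have "\<dots> \<le> 2 * ?D + int t + int (k div 2) + (if odd k then ?D else 0)"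
      proof (rule game_value_Impish_le[OF finV])
        show "V - dom (m(v \<mapsto> 0)) \<noteq> {}" using False dom0 by simp
      next
        fix u assume "u \<in> V - dom (m(v \<mapsto> 0))"
        then have u: "u \<in> V - dom m - {v}" using dom0 by simp
        have "V - dom (m(v \<mapsto> 0, u \<mapsto> 1)) = V - dom m - {v} - {u}" by auto
        then have k': "card (V - dom (m(v \<mapsto> 0, u \<mapsto> 1))) = k - 2"
          using card(1)[OF u] by simp
        have "game_value V E Admirable (m(v \<mapsto> 0, u \<mapsto> 1)) \<le>
          2 * ?D + int (Suc t) + int ((k - 2) div 2) + (if odd (k - 2) then ?D else 0)"
        proof (rule less.IH)
          show "k - 2 < k" using card(2)[OF u] by simp
          show "ran (m(v \<mapsto> 0, u \<mapsto> 1)) \<subseteq> {0, 1}" by (rule ran_upd_subset[OF ran0]) simp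
        qed (use inv[OF u] k' in blast)+
        \<comment> \<open>The increase of \<open>t\<close> is paid for by the round used up, so
          \<open>t + k div 2\<close> stays constant.\<close>
        moreover have "Suc ((k - 2) div 2) = k div 2" "odd (k - 2) = odd k"
          using card(2)[OF u] by presburger+
        ultimately show "game_value V E Admirable (m(v \<mapsto> 0, u \<mapsto> 1)) \<le>
          2 * ?D + int t + int (k div 2) + (if odd k then ?D else 0)"
          by (auto split: if_splits)
      qed
      finally show ?thesis .
    qed
  qed
qed

section \<open>The two starting positions\<close>

lemma spin_sum_empty: "simple_graph V E \<Longrightarrow> spin_sum E (spin Map.empty) = 0"
  by (auto simp: spin_sum_def spin_def simple_graph_def card_2_iff intro!: sum.neutral)

lemma cordiality_A_le:
  assumes "simple_graph V E"
  shows "cordiality_A V E \<le> 2 * int (max_degree V E) + int (card V div 2)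
           + (if odd (card V) then int (max_degree V E) else 0)"
  using game_value_bound[OF assms, of Map.empty 0] spin_sum_empty[OF assms]
  by (simp add: cordiality_A_def)

text \<open>After Impish's opening move Admirable is to move with one vertex fewer, which swaps the
  roles of even and odd order. The empty graph is treated apart because it admits no opening
  move.\<close>

lemma cordiality_I_le:
  assumes G: "simple_graph V E"
  shows "cordiality_I V E \<le> 2 * int (max_degree V E) + int (card V div 2)
           + (if even (card V) then int (max_degree V E) else 0)"
proof (cases "V = {}")
  case True
  then show ?thesis
    using game_value_final[OF G, of Map.empty Impish] spin_sum_empty[OF G]
    by (simp add: cordiality_I_def)
next
  case False
  let ?D = "int (max_degree V E)"
  have finV: "finite V" using simple_graph_finite[OF G] .
  show ?thesis
    unfolding cordiality_I_def
  proof (rule game_value_Impish_le[OF finV])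
    show "V - dom Map.empty \<noteq> {}" using False by simp
  next
    fix v assume "v \<in> V - dom (Map.empty :: 'a \<rightharpoonup> nat)"
    then have v: "v \<in> V" by simp
    \<comment> \<open>No neighbor of \<open>v\<close> is labeled yet, so the opening move leaves the
      sum at 0 and the invariant holds with \<open>t = 0\<close>.\<close>
    have "weight E (spin Map.empty) v = 0"
      using G by (auto simp: weight_def spin_def simple_graph_def card_2_iff intro!: sum.neutral)
    then have "spin_sum E (spin [v \<mapsto> 1]) = 0"
      using spin_sum_upd[OF G, of "spin Map.empty" v "-1"] spin_sum_empty[OF G]
      by (simp add: spin_upd[where i = "Suc 0"] spin_notin_dom)
    moreover have "card (V - dom [v \<mapsto> 1 :: nat]) = card V - 1" using finV v by simp
    ultimately have "game_value V E Admirable [v \<mapsto> 1] \<le>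
      2 * ?D + int ((card V - 1) div 2) + (if odd (card V - 1) then ?D else 0)"
      using game_value_bound[OF G, of "[v \<mapsto> 1]" 0 "card V - 1"] by simp
    \<comment> \<open>For even \<open>card V\<close> this estimate gives away 1; for odd
      \<open>card V\<close> it is an equality.\<close>
    moreover have "(card V - 1) div 2 \<le> card V div 2" by (simp add: div_le_mono)
    moreover have "odd (card V - 1) = even (card V)"
      using finV v card_gt_0_iff[of V] by auto
    ultimately show "game_value V E Admirable [v \<mapsto> 1] \<le>
      2 * ?D + int (card V div 2) + (if even (card V) then ?D else 0)"
      by (auto split: if_splits)
  qed
qed

theorem theorem5p2:
  fixes V :: "'a set" and E :: "'a set set" and n \<Delta> :: nat
  assumes "simple_graph V E"
    and "n = card V"
    and "\<Delta> = max_degree V E"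
  shows "(even n \<longrightarrow>
            real_of_int (cordiality_A V E) \<le> real n / 2 + 2 * real \<Delta> \<and>
            real_of_int (cordiality_I V E) \<le> real n / 2 + 3 * real \<Delta>) \<and>
         (odd n \<longrightarrow>
            real_of_int (cordiality_A V E) \<le> real n / 2 + 3 * real \<Delta> \<and>
            real_of_int (cordiality_I V E) \<le> real n / 2 + 2 * real \<Delta>)"
proof -
  \<comment> \<open>For odd \<open>n\<close> the integer bounds are sharper than the stated ones by
    1/2.\<close>
  have half: "real (n div 2) \<le> real n / 2" by linarith
  have A: "real_of_int (cordiality_A V E)
      \<le> 2 * real \<Delta> + real (n div 2) + (if odd n then real \<Delta> else 0)"
    using of_int_le_iff[where ?'a = real, THEN iffD2, OF cordiality_A_le[OF assms(1)]] assms(2,3)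
    by (auto split: if_splits)
  have I: "real_of_int (cordiality_I V E)
      \<le> 2 * real \<Delta> + real (n div 2) + (if even n then real \<Delta> else 0)"
    using of_int_le_iff[where ?'a = real, THEN iffD2, OF cordiality_I_le[OF assms(1)]] assms(2,3)
    by (auto split: if_splits)
  show ?thesis using half A I by auto
qed

end
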